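(* Let $G,H$, $(h_w)_{w>0}$, $(B_w(t))_{t\in H,\,w>0}$, $(\chi_w)_{w>0}$ and the operators $(S_w)_{w>0}$ be as in the context (in particular the kernels satisfy $(\chi_1)$–$(\chi_5)$). Let $f\in C(G)$. Then $$\lim_{w\to\infty}\|S_wf-f\|_\infty=0.$$
   Context: Setting. $H$ and $G$ are locally compact Hausdorff topological groups with regular Haar measures $\mu_H$ and $\mu_G$; $G$ is abelian. Group operations are written additively; $\theta_G$ is the neutral element of $G$. $\mathcal B$ is a countable symmetric local base of neighbourhoods of $\theta_G$ in $G$, ordered by inclusion, such that for each $U\in\mathcal B$ there is $V\in\mathcal B$ with $V+V\subset U$ and $V-V\subset U$. For every $w>0$, $h_w:H\to G$ is a map which is a homeomorphism from $H$ onto $h_w(H)$, and $(B_w(t))_{t\in H}$ is a family of open nonempty subsets of $G$ such that: (i) $0<\mu_G(B_w(t))<\infty$ for all $t\in H$, $w>0$; (ii) $h_w(t)\in B_w(t)$ for all $t\in H$, $w>0$; (iii) for every $B\in\mathcal B$ there is $\overline w>0$ such that for every $w>\overline w$, $h_w(t)-B_w(t)\subset B$ for every $t\in H$. Kernels. $(\chi_w)_{w>0}$ is a family of measurable functions $\chi_w:G\to\mathbb R$ with $\chi_w\in L^1(G)$ and $\chi_w$ bounded in a neighbourhood of $\theta_G$, such that: $(\chi_1)$ for every $w>0$ and $z\in G$ the map $t\mapsto\chi_w(z-h_w(t))$ belongs to $L^1(H)$; $(\chi_2)$ $\int_H\chi_w(z-h_w(t))\,d\mu_H(t)=1$ for every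 $w>0$, $z\in G$; $(\chi_3)$ there is a constant $M<+\infty$ such that for every $w>0$, $m_{0,\pi}(\chi_w):=\sup_{z\in G}\int_H|\chi_w(z-h_w(t))|\,d\mu_H(t)<M$; $(\chi_4)$ for every $B\in\mathcal B$, setting $B_{z,w}=\{t\in H: z-h_w(t)\in B\}$, one has $\lim_{w\to\infty}\int_{H\setminus B_{z,w}}|\chi_w(z-h_w(t))|\,d\mu_H(t)=0$ uniformly with respect to $z\in G$; $(\chi_5)$ for every $\varepsilon>0$ and every compact $K\subset G$ there is a symmetric compact set $C\subset G$ containing $\theta_G$, with $\mu_G(C)<\infty$, such that $\int_{z\notin C}\Upsilon_w(K)\,|\chi_w(z-h_w(t))|\,d\mu_G(z)<\varepsilon$ for every sufficiently large $w>0$ and every $t\in H$ with $h_w(t)\in K$, where $\Upsilon_w(K):=\mu_H\{t\in H: h_w(t)\in K\}$. Operators. For $w>0$ and measurable $f:G\to\mathbb R$ for which the integrals are well defined, $$S_wf(z)=\int_H\chi_w(z-h_w(t))\left[\frac1{\mu_G(B_w(t))}\int_{B_w(t)}f(u)\,d\mu_G(u)\right]d\mu_H(t),\quad z\in G.$$ Function space. $C(G)$ is the set of bounded uniformly continuous functions $f:G\to\mathbb R$ with the norm $\|\cdot\|_\infty$, where uniform continuity means: for every $\varepsilon>0$ there is a compact set $B_\varepsilon\in\mathcal B$ such that $|f(s)-f(z)|<\varepsilon$ whenever $s,z\in G$ and $s-z\in B_\varepsilon$. *)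

theory Defs
  imports "HOL-Analysis.Analysis"
begin

text \<open>
  The groups are the whole types \<open>'h\<close> and \<open>'g\<close>, written additively; \<open>group_add\<close> is not
  commutative. Invariance is under left translations, the usual convention when the group is
  not abelian. Regularity is outer regularity on Borel sets and inner regularity on open sets.
\<close>

definition regular_haar_measure :: "'a::{topological_group_add, t2_space} measure \<Rightarrow> bool" where
  "regular_haar_measure \<mu> \<longleftrightarrow>
     sets \<mu> = sets borel \<and>
     emeasure \<mu> UNIV \<noteq> 0 \<and>
     (\<forall>x. \<forall>A\<in>sets borel. emeasure \<mu> ((\<lambda>y. x + y) ` A) = emeasure \<mu> A) \<and>
     (\<forall>K. compact K \<longrightarrow> emeasure \<mu> K < \<infinity>) \<and>
     (\<forall>A\<in>sets borel. emeasure \<mu> A = (INF U\<in>{U. open U \<and> A \<subseteq> U}. emeasure \<mu> U)) \<and>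
     (\<forall>U. open U \<longrightarrow> emeasure \<mu> U = (SUP K\<in>{K. compact K \<and> K \<subseteq> U}. emeasure \<mu> K))"

text \<open>
  Members of a local base are neighbourhoods in the wide sense; they need not be open (the
  definition of uniform continuity below asks for compact ones). The order by inclusion is
  the subset relation and imposes no condition.
\<close>

definition symmetric_local_base :: "'g::{topological_ab_group_add, t2_space} set set \<Rightarrow> bool" where
  "symmetric_local_base \<B> \<longleftrightarrow>
     countable \<B> \<and>
     (\<forall>U\<in>\<B>. 0 \<in> interior U \<and> uminus ` U = U) \<and>
     (\<forall>W. open W \<and> 0 \<in> W \<longrightarrow> (\<exists>U\<in>\<B>. U \<subseteq> W)) \<and>
     (\<forall>U\<in>\<B>. \<exists>V\<in>\<B>. {x + y |x y. x \<in> V \<and> y \<in> V} \<subseteq> U \<and> {x - y |x y. x \<in> V \<and> y \<in> V} \<subseteq> U)"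

locale kantorovich_setting =
  fixes \<mu>H :: "'h::{topological_group_add, t2_space} measure"
    and \<mu>G :: "'g::{topological_ab_group_add, t2_space} measure"
    and \<B> :: "'g set set"
    and h :: "real \<Rightarrow> 'h \<Rightarrow> 'g"
    and B :: "real \<Rightarrow> 'h \<Rightarrow> 'g set"
  assumes locally_compact_H: "locally_compact_space (euclidean :: 'h topology)"
    and locally_compact_G: "locally_compact_space (euclidean :: 'g topology)"
    and haar_H: "regular_haar_measure \<mu>H"
    and haar_G: "regular_haar_measure \<mu>G"
    and local_base: "symmetric_local_base \<B>"
    and h_homeomorphism: "\<And>w. w > 0 \<Longrightarrow> \<exists>k. homeomorphism UNIV (range (h w)) (h w) k"
    and B_open: "\<And>w t. w > 0 \<Longrightarrow> open (B w t)"
    and B_nonempty: "\<And>w t. w > 0 \<Longrightarrow> B w t \<noteq> {}"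
    and B_emeasure: "\<And>w t. w > 0 \<Longrightarrow> 0 < emeasure \<mu>G (B w t) \<and> emeasure \<mu>G (B w t) < \<infinity>"
    and h_in_B: "\<And>w t. w > 0 \<Longrightarrow> h w t \<in> B w t"
    and B_shrinks: "\<And>U. U \<in> \<B> \<Longrightarrow> \<exists>w0>0. \<forall>w>w0. \<forall>t. {h w t - u |u. u \<in> B w t} \<subseteq> U"

text \<open>
  Integrals of nonnegative functions, and suprema of them, are taken in \<open>ennreal\<close>. In
  \<open>chi4\<close> the set \<open>U\<close> need not be Borel; if it is not, \<open>nn_integral\<close> is the lower integral,
  so that the condition remains a genuine one. In \<open>chi5\<close> the factor \<open>\<Upsilon>\<^sub>w(K)\<close> may be infinite.
\<close>

locale kantorovich_kernels = kantorovich_setting \<mu>H \<mu>G \<B> h B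
  for \<mu>H :: "'h::{topological_group_add, t2_space} measure"
    and \<mu>G :: "'g::{topological_ab_group_add, t2_space} measure"
    and \<B> h B +
  fixes chi :: "real \<Rightarrow> 'g \<Rightarrow> real"
  assumes chi_L1: "\<And>w. w > 0 \<Longrightarrow> integrable \<mu>G (chi w)"
    and chi_bounded_near_0: "\<And>w. w > 0 \<Longrightarrow> \<exists>N. 0 \<in> interior N \<and> bounded (chi w ` N)"
    and chi1: "\<And>w z. w > 0 \<Longrightarrow> integrable \<mu>H (\<lambda>t. chi w (z - h w t))"
    and chi2: "\<And>w z. w > 0 \<Longrightarrow> (LINT t|\<mu>H. chi w (z - h w t)) = 1"
    and chi3: "\<exists>M<\<infinity>. \<forall>w>0. (SUP z. (\<integral>\<^sup>+ t. ennreal \<bar>chi w (z - h w t)\<bar> \<partial>\<mu>H)) < M"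
    and chi4: "\<And>U \<epsilon>. U \<in> \<B> \<Longrightarrow> \<epsilon> > 0 \<Longrightarrow>
      \<forall>\<^sub>F w in at_top. \<forall>z.
        (\<integral>\<^sup>+ t \<in> UNIV - {t. z - h w t \<in> U}. ennreal \<bar>chi w (z - h w t)\<bar> \<partial>\<mu>H) < ennreal \<epsilon>"
    and chi5: "\<And>\<epsilon> K. \<epsilon> > 0 \<Longrightarrow> compact K \<Longrightarrow>
      \<exists>C. compact C \<and> uminus ` C = C \<and> 0 \<in> C \<and> emeasure \<mu>G C < \<infinity> \<and>
        (\<forall>\<^sub>F w in at_top. \<forall>t. h w t \<in> K \<longrightarrow>
          (\<integral>\<^sup>+ z \<in> UNIV - C. emeasure \<mu>H {s. h w s \<in> K} * ennreal \<bar>chi w (z - h w t)\<bar> \<partial>\<mu>G) < ennreal \<epsilon>)"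

definition B_mean :: "'g measure \<Rightarrow> (real \<Rightarrow> 'h \<Rightarrow> 'g set) \<Rightarrow> real \<Rightarrow> ('g \<Rightarrow> real) \<Rightarrow> 'h \<Rightarrow> real" where
  "B_mean \<mu>G B w f t = 1 / measure \<mu>G (B w t) * (LINT u:B w t|\<mu>G. f u)"

definition S_op ::
  "'h measure \<Rightarrow> 'g measure \<Rightarrow> (real \<Rightarrow> 'h \<Rightarrow> 'g::minus) \<Rightarrow> (real \<Rightarrow> 'h \<Rightarrow> 'g set) \<Rightarrow>
   (real \<Rightarrow> 'g \<Rightarrow> real) \<Rightarrow> real \<Rightarrow> ('g \<Rightarrow> real) \<Rightarrow> 'g \<Rightarrow> real" where
  "S_op \<mu>H \<mu>G h B chi w f z = (LINT t|\<mu>H. chi w (z - h w t) * B_mean \<mu>G B w f t)"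

text \<open>
  The functions for which the integrals in the definition of the operator make sense. No
  regularity of \<open>t \<mapsto> B\<^sub>w(t)\<close> is assumed, so the mean may fail to be measurable in
  \<open>t\<close> even if \<open>f\<close> is bounded and uniformly continuous; the Bochner integral above would
  then be \<open>0\<close> by convention.
\<close>

definition S_domain ::
  "'h measure \<Rightarrow> 'g measure \<Rightarrow> (real \<Rightarrow> 'h \<Rightarrow> 'g::minus) \<Rightarrow> (real \<Rightarrow> 'h \<Rightarrow> 'g set) \<Rightarrow>
   (real \<Rightarrow> 'g \<Rightarrow> real) \<Rightarrow> real \<Rightarrow> ('g \<Rightarrow> real) set" where
  "S_domain \<mu>H \<mu>G h B chi w =
     {f \<in> borel_measurable \<mu>G.
        (\<forall>t. set_integrable \<mu>G (B w t) f) \<and>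
        (\<forall>z. integrable \<mu>H (\<lambda>t. chi w (z - h w t) * B_mean \<mu>G B w f t))}"

definition bounded_unif_cont :: "'g::{topological_ab_group_add, t2_space} set set \<Rightarrow> ('g \<Rightarrow> real) set" where
  "bounded_unif_cont \<B> =
     {f. bounded (range f) \<and>
         (\<forall>\<epsilon>>0. \<exists>U\<in>\<B>. compact U \<and> (\<forall>s z. s - z \<in> U \<longrightarrow> \<bar>f s - f z\<bar> < \<epsilon>))}"

definition sup_norm :: "('a \<Rightarrow> real) \<Rightarrow> ennreal" where
  "sup_norm f = (SUP z. ennreal \<bar>f z\<bar>)"

end

theory Submission
  imports Defs
begin

text \<open>
  By \<open>chi2\<close> the error at \<open>z\<close> is the integral of \<open>\<chi>\<^sub>w(z - h\<^sub>w(t))\<close> against the difference of the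
  mean of \<open>f\<close> over \<open>B\<^sub>w(t)\<close> and \<open>f(z)\<close>. If \<open>z - h\<^sub>w(t)\<close> lies in a small neighbourhood of \<open>0\<close>, then
  \<open>B\<^sub>w(t)\<close> lies near \<open>z\<close> for large \<open>w\<close>, so this difference is small by uniform continuity and \<open>chi3\<close>
  bounds the contribution; elsewhere the difference is bounded and \<open>chi4\<close> applies.
\<close>

text \<open>Integrating the constants \<open>c - d\<close> and \<open>c + d\<close> over
  \<open>B w t\<close> encloses the integral of \<open>f\<close>; dividing by the measure gives the
  claim.\<close>

lemma abs_B_mean_diff_le:
  assumes int: "set_integrable M (B w t) f"
    and sets: "B w t \<in> sets M"
    and pos: "0 < emeasure M (B w t)" and fin: "emeasure M (B w t) < \<infinity>"
    and bound: "\<And>u. u \<in> B w t \<Longrightarrow> \<bar>f u - c\<bar> \<le> d"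
  shows "\<bar>B_mean M B w f t - c\<bar> \<le> d"
proof -
  let ?A = "B w t"
  let ?m = "measure M ?A"
  \<comment> \<open>Finiteness matters here: \<open>measure\<close> is \<open>0\<close> on sets of
    infinite measure.\<close>
  have m: "?m > 0"
    using pos fin by (simp add: measure_def enn2real_positive_iff)
  have const: "set_integrable M ?A (\<lambda>_. k)" "(LINT u:?A|M. k) = ?m * k" for k :: real
    using fin sets by (simp_all add: set_integrable_def set_lebesgue_integral_def)
  have "(LINT u:?A|M. c - d) \<le> (LINT u:?A|M. f u)"
    by (rule set_integral_mono[OF const(1) int]) (use bound in fastforce)
  moreover have "(LINT u:?A|M. f u) \<le> (LINT u:?A|M. c + d)"
    by (rule set_integral_mono[OF int const(1)]) (use bound in fastforce)
  ultimately have "?m * (c - d) \<le> (LINT u:?A|M. f u)" "(LINT u:?A|M. f u) \<le> ?m * (c + d)"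
    by (simp_all only: const(2))
  then have "c - d \<le> B_mean M B w f t" "B_mean M B w f t \<le> c + d"
    using m by (simp_all add: B_mean_def field_simps)
  then show ?thesis by linarith
qed

lemma sup_norm_tendsto_0I:
  fixes F :: "'b \<Rightarrow> 'a \<Rightarrow> real"
  assumes "\<And>e. e > 0 \<Longrightarrow> \<forall>\<^sub>F w in \<F>. \<forall>z. \<bar>F w z\<bar> \<le> e"
  shows "((\<lambda>w. sup_norm (F w)) \<longlongrightarrow> 0) \<F>"
proof (rule order_tendstoI)
  fix a :: ennreal assume "0 < a"
  \<comment> \<open>An intermediate \<open>b\<close> is finite even when \<open>a\<close> is
    \<open>top\<close>, hence a positive real. It also leaves room for strictness, since pointwise
    bounds only give \<open>\<le>\<close> for the supremum.\<close>
  then obtain b where b: "0 < b" "b < a" using dense by blast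
  then have "b < top" using top.not_eq_extremum by fastforce
  with b obtain e where e: "e > 0" "b = ennreal e"
    by (cases b) auto
  show "\<forall>\<^sub>F w in \<F>. sup_norm (F w) < a"
    using assms[OF e(1)]
  proof eventually_elim
    case (elim w)
    then have "sup_norm (F w) \<le> b"
      unfolding sup_norm_def e(2) by (intro SUP_least ennreal_leI) auto
    with b show ?case by order
  qed
qed simp

context kantorovich_kernels
begin

lemma continuous_h: "w > 0 \<Longrightarrow> continuous_on UNIV (h w)"
  using h_homeomorphism homeomorphism_def by blast

lemma chi_nn_integral_bound:
  "\<exists>M>0. \<forall>w>0. \<forall>z. (\<integral>\<^sup>+ t. ennreal \<bar>chi w (z - h w t)\<bar> \<partial>\<mu>H) \<le> ennreal M"
proof -
  obtain M where M: "M < \<infinity>" "\<And>w. w > 0 \<Longrightarrow> (SUP z. \<integral>\<^sup>+ t. ennreal \<bar>chi w (z - h w t)\<bar> \<partial>\<mu>H) < M"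
    using chi3 by auto
  then obtain r where r: "r \<ge> 0" "M = ennreal r" by (cases M) auto
  show ?thesis
  \<comment> \<open>Adding \<open>1\<close> makes the constant visibly positive, so that it can
    serve as a divisor later.\<close>
  proof (intro exI[of _ "r + 1"] conjI allI impI)
    fix w :: real and z assume "w > 0"
    have "(\<integral>\<^sup>+ t. ennreal \<bar>chi w (z - h w t)\<bar> \<partial>\<mu>H) \<le> (SUP z. \<integral>\<^sup>+ t. ennreal \<bar>chi w (z - h w t)\<bar> \<partial>\<mu>H)"
      by (rule SUP_upper) simp
    also have "\<dots> \<le> ennreal r" using M(2)[OF \<open>w > 0\<close>] r by simp
    also have "\<dots> \<le> ennreal (r + 1)" by (rule ennreal_leI) simp
    finally show "(\<integral>\<^sup>+ t. ennreal \<bar>chi w (z - h w t)\<bar> \<partial>\<mu>H) \<le> ennreal (r + 1)" .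
  qed (use r in simp)
qed

text \<open>The estimate for fixed \<open>w\<close> and \<open>z\<close>: the near part costs at
  most \<open>\<delta>\<close> times the full kernel mass, the far part at most \<open>b\<close>
  times the mass outside \<open>V\<close>. Openness of \<open>V\<close> makes the splitting set
  Borel.\<close>

lemma S_op_error_le:
  assumes w: "w > 0" and f: "f \<in> S_domain \<mu>H \<mu>G h B chi w"
    and V: "open V" and nonneg: "0 \<le> \<delta>" "0 \<le> b" "0 \<le> M" "0 \<le> \<eta>"
    and near: "\<And>t. z - h w t \<in> V \<Longrightarrow> \<bar>B_mean \<mu>G B w f t - f z\<bar> \<le> \<delta>"
    and far: "\<And>t. \<bar>B_mean \<mu>G B w f t - f z\<bar> \<le> b"
    and I1: "(\<integral>\<^sup>+ t. ennreal \<bar>chi w (z - h w t)\<bar> \<partial>\<mu>H) \<le> ennreal M"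
    and I2: "(\<integral>\<^sup>+ t \<in> - {t. z - h w t \<in> V}. ennreal \<bar>chi w (z - h w t)\<bar> \<partial>\<mu>H) \<le> ennreal \<eta>"
  shows "\<bar>S_op \<mu>H \<mu>G h B chi w f z - f z\<bar> \<le> \<delta> * M + b * \<eta>"
proof -
  let ?c = "\<lambda>t. chi w (z - h w t)" and ?m = "B_mean \<mu>G B w f"
  define A where "A = {t. z - h w t \<in> V}"
  have "continuous_on UNIV (\<lambda>t. z - h w t)"
    using continuous_h[OF w] by (intro continuous_intros)
  then have "open A"
    using open_vimage[OF V] by (simp add: A_def vimage_def)
  then have A [measurable]: "- A \<in> sets \<mu>H"
    using haar_H by (simp add: regular_haar_measure_def)
  note c = chi1[OF w, of z]
  have [measurable]: "?c \<in> borel_measurable \<mu>H" using c by simp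
  \<comment> \<open>This integrability rules out the default value \<open>0\<close> of the Bochner
    integral and permits subtracting \<open>f z\<close> under the integral.\<close>
  have cm: "integrable \<mu>H (\<lambda>t. ?c t * ?m t)" using f by (simp add: S_domain_def)
  have int: "integrable \<mu>H (\<lambda>t. ?c t * (?m t - f z))"
    using cm c by (simp add: right_diff_distrib)
  have "S_op \<mu>H \<mu>G h B chi w f z - f z = (LINT t|\<mu>H. ?c t * (?m t - f z))"
    using cm c by (simp add: S_op_def right_diff_distrib chi2[OF w])
  then have "ennreal \<bar>S_op \<mu>H \<mu>G h B chi w f z - f z\<bar> \<le> (\<integral>\<^sup>+ t. ennreal \<bar>?c t * (?m t - f z)\<bar> \<partial>\<mu>H)"
    using integral_norm_bound_ennreal[OF int] by simp
  \<comment> \<open>The first summand is not restricted to \<open>A\<close>: off \<open>A\<close> it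
    is only slack, and its integral is then the full mass bounded by \<open>I1\<close>.\<close>
  also have "\<dots> \<le> (\<integral>\<^sup>+ t. ennreal \<delta> * ennreal \<bar>?c t\<bar> + ennreal b * (ennreal \<bar>?c t\<bar> * indicator (- A) t) \<partial>\<mu>H)"
  proof (rule nn_integral_mono)
    fix t
    show "ennreal \<bar>?c t * (?m t - f z)\<bar>
      \<le> ennreal \<delta> * ennreal \<bar>?c t\<bar> + ennreal b * (ennreal \<bar>?c t\<bar> * indicator (- A) t)"
    proof (cases "t \<in> A")
      case True
      then have "\<bar>?c t * (?m t - f z)\<bar> \<le> \<delta> * \<bar>?c t\<bar>"
        using near[of t] by (simp add: A_def abs_mult mult.commute[of \<delta>] mult_left_mono)
      then show ?thesis using True nonneg by (simp add: ennreal_leI flip: ennreal_mult)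
    next
      case False
      have "\<bar>?c t * (?m t - f z)\<bar> \<le> b * \<bar>?c t\<bar>"
        using far[of t] by (simp add: abs_mult mult.commute[of b] mult_left_mono)
      also have "\<dots> \<le> \<delta> * \<bar>?c t\<bar> + b * \<bar>?c t\<bar>" using nonneg by simp
      finally show ?thesis using False nonneg
        by (simp add: ennreal_leI flip: ennreal_mult ennreal_plus)
    qed
  qed
  also have "\<dots> = ennreal \<delta> * (\<integral>\<^sup>+ t. ennreal \<bar>?c t\<bar> \<partial>\<mu>H)
      + ennreal b * (\<integral>\<^sup>+ t \<in> - A. ennreal \<bar>?c t\<bar> \<partial>\<mu>H)"
    by (simp add: nn_integral_add nn_integral_cmult)
  also have "\<dots> \<le> ennreal \<delta> * ennreal M + ennreal b * ennreal \<eta>"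
    using I1 I2 by (intro add_mono mult_left_mono) (auto simp: A_def)
  also have "\<dots> = ennreal (\<delta> * M + b * \<eta>)"
    using nonneg by (simp add: ennreal_mult ennreal_plus)
  finally show ?thesis using nonneg by (subst (asm) ennreal_le_iff) auto
qed

end

theorem theorem3p1:
  fixes \<mu>H :: "'h::{topological_group_add, t2_space} measure"
    and \<mu>G :: "'g::{topological_ab_group_add, t2_space} measure"
    and \<B> :: "'g set set"
    and h :: "real \<Rightarrow> 'h \<Rightarrow> 'g"
    and B :: "real \<Rightarrow> 'h \<Rightarrow> 'g set"
    and chi :: "real \<Rightarrow> 'g \<Rightarrow> real"
    and f :: "'g \<Rightarrow> real"
  assumes "kantorovich_kernels \<mu>H \<mu>G \<B> h B chi"
    and "f \<in> bounded_unif_cont \<B>"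
    and "\<And>w. w > 0 \<Longrightarrow> f \<in> S_domain \<mu>H \<mu>G h B chi w"
  shows "((\<lambda>w. sup_norm (\<lambda>z. S_op \<mu>H \<mu>G h B chi w f z - f z)) \<longlongrightarrow> 0) at_top"
proof (rule sup_norm_tendsto_0I)
  interpret kantorovich_kernels \<mu>H \<mu>G \<B> h B chi by (rule assms(1))
  fix e :: real assume e: "e > 0"
  obtain M where M: "M > 0"
    "\<And>w z. w > 0 \<Longrightarrow> (\<integral>\<^sup>+ t. ennreal \<bar>chi w (z - h w t)\<bar> \<partial>\<mu>H) \<le> ennreal M"
    using chi_nn_integral_bound by meson
  obtain N where N: "N > 0" "\<And>u. \<bar>f u\<bar> \<le> N"
    using assms(2) by (auto simp: bounded_unif_cont_def bounded_pos)
  \<comment> \<open>The near part has mass at most \<open>M\<close>, and the far difference is at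
    most \<open>2 * N\<close>, so each part contributes at most \<open>e / 2\<close>.\<close>
  define \<delta> where "\<delta> = e / (2 * M)"
  define \<eta> where "\<eta> = e / (4 * N)"
  have pos: "\<delta> > 0" "\<eta> > 0" and total: "\<delta> * M + 2 * N * \<eta> = e"
    using e M(1) N(1) by (simp_all add: \<delta>_def \<eta>_def)
  obtain U where U: "U \<in> \<B>" "\<And>s z. s - z \<in> U \<Longrightarrow> \<bar>f s - f z\<bar> < \<delta>"
    using assms(2) pos(1) by (auto simp: bounded_unif_cont_def)
  have base: "\<And>W. open W \<and> 0 \<in> W \<Longrightarrow> \<exists>U\<in>\<B>. U \<subseteq> W"
    using local_base by (simp add: symmetric_local_base_def)
  \<comment> \<open>One summand will be \<open>z - h w t\<close>, the other \<open>h w t - u\<close>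
    with \<open>u\<close> in \<open>B w t\<close>; their sum is \<open>z - u\<close>.\<close>
  obtain V where V: "V \<in> \<B>" "{x + y |x y. x \<in> V \<and> y \<in> V} \<subseteq> U"
    using local_base U(1) unfolding symmetric_local_base_def by meson
  \<comment> \<open>\<open>V\<close> need not be Borel, so the domain of integration is split along \<open>interior V\<close>; \<open>chi4\<close> is
    used for \<open>W \<subseteq> interior V\<close>, by monotonicity alone.\<close>
  have "open (interior V)" "0 \<in> interior V"
    using local_base V(1) by (auto simp: symmetric_local_base_def)
  then obtain W where W: "W \<in> \<B>" "W \<subseteq> interior V"
    using base[of "interior V"] by blast
  obtain w0 where w0: "w0 > 0" "\<And>w t. w > w0 \<Longrightarrow> {h w t - u |u. u \<in> B w t} \<subseteq> V"
    using B_shrinks[OF V(1)] by meson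
  \<comment> \<open>Neither threshold for \<open>w\<close> depends on \<open>z\<close>:
    \<open>B_shrinks\<close> is uniform in \<open>t\<close> and \<open>chi4\<close> in
    \<open>z\<close>. This makes the convergence uniform.\<close>
  show "\<forall>\<^sub>F w in at_top. \<forall>z. \<bar>S_op \<mu>H \<mu>G h B chi w f z - f z\<bar> \<le> e"
    using eventually_gt_at_top[of w0] chi4[OF W(1) pos(2)]
  proof eventually_elim
    case (elim w)
    then have w: "w > 0" using w0(1) by simp
    note dom = assms(3)[OF w]
    have sets: "B w t \<in> sets \<mu>G" for t
      using B_open[OF w] haar_G by (simp add: regular_haar_measure_def)
    have mean: "\<bar>B_mean \<mu>G B w f t - c\<bar> \<le> d"
      if "\<And>u. u \<in> B w t \<Longrightarrow> \<bar>f u - c\<bar> \<le> d" for t c d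
      using that dom sets B_emeasure[OF w] by (intro abs_B_mean_diff_le) (auto simp: S_domain_def)
    show ?case
    proof
      fix z
      have near: "\<bar>B_mean \<mu>G B w f t - f z\<bar> \<le> \<delta>" if "z - h w t \<in> interior V" for t
      proof (rule mean)
        fix u assume "u \<in> B w t"
        then have "h w t - u \<in> V" using w0(2)[OF elim(1)] by blast
        moreover have "z - h w t \<in> V" using that interior_subset by blast
        ultimately have "(z - h w t) + (h w t - u) \<in> U" using V(2) by blast
        then have "z - u \<in> U" by simp
        then show "\<bar>f u - f z\<bar> \<le> \<delta>" using U(2)[of z u] by (simp add: abs_minus_commute)
      qed
      have far: "\<bar>B_mean \<mu>G B w f t - f z\<bar> \<le> 2 * N" for t
      proof (rule mean)
        fix u
        show "\<bar>f u - f z\<bar> \<le> 2 * N" using N(2)[of u] N(2)[of z] by linarith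
      qed
      have "(\<integral>\<^sup>+ t \<in> - {t. z - h w t \<in> interior V}. ennreal \<bar>chi w (z - h w t)\<bar> \<partial>\<mu>H)
          \<le> (\<integral>\<^sup>+ t \<in> UNIV - {t. z - h w t \<in> W}. ennreal \<bar>chi w (z - h w t)\<bar> \<partial>\<mu>H)"
        using W(2) by (intro nn_integral_mono mult_left_mono) (auto simp: indicator_def)
      also have "\<dots> \<le> ennreal \<eta>" using elim(2) by (simp add: less_imp_le)
      finally have "\<bar>S_op \<mu>H \<mu>G h B chi w f z - f z\<bar> \<le> \<delta> * M + 2 * N * \<eta>"
        using pos M(1) N(1) by (intro S_op_error_le[OF w dom open_interior _ _ _ _ near far M(2)[OF w]]) auto
      then show "\<bar>S_op \<mu>H \<mu>G h B chi w f z - f z\<bar> \<le> e" by (simp only: total)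
    qed
  qed
qed

end
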